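(* Let $\eta\in\mathbb{R}$, $\lambda>-1/2$, $b=\lambda+i\eta$, and consider the weight function on the unit circle $$w(\theta)=\tau(b)\,e^{-\eta\theta}[\sin^2(\theta/2)]^{\lambda},\quad\theta\in[0,2\pi],\qquad \tau(b)=\frac{e^{\pi\eta}\,2^{b+\overline b}\,|\Gamma(b+1)|^2}{2\pi\,\Gamma(b+\overline b+1)}.$$ The associated Verblunsky coefficients $\alpha_n$ satisfy the non-linear difference equation $$\overline{\alpha}_n(\alpha_{n-1}+\alpha_n)=(\overline b+n)\big(|\alpha_{n-1}|^2-|\alpha_n|^2\big),\qquad n\ge1.$$
   Context: For a weight function $w$ on $[0,2\pi]$, put $\langle f,g\rangle=\int_0^{2\pi}f(e^{i\theta})\overline{g(e^{i\theta})}\,w(\theta)\,d\theta$. The monic orthogonal polynomials on the unit circle $\Phi_n$ ($n\ge0$) are the monic polynomials of degree $n$ with $\langle\Phi_n,z^k\rangle=0$ for $0\le k\le n-1$. The Verblunsky coefficients are $\alpha_{n-1}=-\overline{\Phi_n(0)}$ for $n\ge0$ (so $\alpha_{-1}=-1$). *)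

theory Defs
  imports "HOL-Analysis.Analysis" "HOL-Computational_Algebra.Polynomial"
begin

definition circle_inner ::
    "(real \<Rightarrow> real) \<Rightarrow> (complex \<Rightarrow> complex) \<Rightarrow> (complex \<Rightarrow> complex) \<Rightarrow> complex" where
  "circle_inner w f g =
     (LBINT \<theta>:{0..2*pi}. f (cis \<theta>) * cnj (g (cis \<theta>)) * complex_of_real (w \<theta>))"

definition is_monic_opuc :: "(real \<Rightarrow> real) \<Rightarrow> nat \<Rightarrow> complex poly \<Rightarrow> bool" where
  "is_monic_opuc w n p \<longleftrightarrow>
     degree p = n \<and> lead_coeff p = 1 \<and> (\<forall>k<n. circle_inner w (poly p) (\<lambda>z. z ^ k) = 0)"

(* The description is proper whenever w is nonnegative, integrable and not a.e. zero. *)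
definition monic_opuc :: "(real \<Rightarrow> real) \<Rightarrow> nat \<Rightarrow> complex poly" where
  "monic_opuc w n = (THE p. is_monic_opuc w n p)"

(* Indexed by the integers to include the index -1; only indices k >= -1 are meaningful. *)
definition verblunsky :: "(real \<Rightarrow> real) \<Rightarrow> int \<Rightarrow> complex" where
  "verblunsky w k = - cnj (poly (monic_opuc w (nat (k + 1))) 0)"

lemma is_monic_opuc_0_iff: "is_monic_opuc w 0 p \<longleftrightarrow> p = 1"
  unfolding is_monic_opuc_def by (auto elim!: degree_eq_zeroE)

lemma verblunsky_minus_one: "verblunsky w (-1) = -1"
  by (simp add: verblunsky_def monic_opuc_def is_monic_opuc_0_iff)

(* Real-valued since b + cnj b = 2 Re b; see tau_eq for the form with b + cnj b. *)
definition tau :: "complex \<Rightarrow> real" where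
  "tau b = exp (pi * Im b) * 2 powr (2 * Re b) * (norm (Gamma (b + 1)))\<^sup>2
             / (2 * pi * Gamma (2 * Re b + 1))"

lemma tau_eq:
  "complex_of_real (tau b) =
     exp (of_real (pi * Im b)) * 2 powr (b + cnj b) * (of_real (norm (Gamma (b + 1))))\<^sup>2
       / (2 * of_real pi * Gamma (b + cnj b + 1))"
proof -
  have *: "b + cnj b = complex_of_real (2 * Re b)"
    by (simp add: complex_add_cnj)
  have G: "Gamma (b + cnj b + 1) = complex_of_real (Gamma (2 * Re b + 1))"
    unfolding * by (simp flip: Gamma_complex_of_real)
  have P: "2 powr (b + cnj b) = complex_of_real (2 powr (2 * Re b))"
    unfolding * by (simp add: powr_of_real[of 2 "2 * Re b", simplified])
  show ?thesis
    unfolding G P tau_def by (simp flip: exp_of_real)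
qed

(* At the endpoints, where sin (t/2) = 0, powr gives 0 whatever lam is; this null set is
   irrelevant to the integrals. *)
definition weight :: "real \<Rightarrow> real \<Rightarrow> real \<Rightarrow> real" where
  "weight \<eta> lam \<theta> = tau (Complex lam \<eta>) * exp (- \<eta> * \<theta>) * ((sin (\<theta> / 2))\<^sup>2) powr lam"

end

theory Submission
  imports Defs
begin

text \<open>
  Write \<open>z = cis \<theta>\<close>. Off the endpoints the weight is smooth, and its logarithmic derivative
  \<open>- \<eta> + lam * cot (\<theta> / 2)\<close> is a rational function of \<open>z\<close> with at most a simple pole, at
  \<open>z = 1\<close>. Multiplying by \<open>1 - z\<close> removes the pole, and it also makes \<open>(1 - z) * w\<close> vanish at both
  endpoints, because its size is that of \<open>sin (\<theta> / 2)\<close> to the power \<open>2 * lam + 1 > 0\<close>. Integrating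
  the derivative of \<open>(1 - z) * p z * z\<^sup>-\<^sup>j * w\<close> over the circle therefore gives, for every
  polynomial \<open>p\<close> and every \<open>j\<close> (lemma \<open>inner_pearson\<close>),

  \<open>\<langle>(1 - z) z p' - cnj b p - (b + 1) z p, z^j\<rangle> = j \<langle>(1 - z) p, z^j\<rangle>\<close>.

  Denote by \<open>L p\<close> the polynomial on the left and put \<open>P\<^sub>0 = 1\<close>, \<open>P\<^sub>n\<^sub>+\<^sub>1 = n P\<^sub>n - L P\<^sub>n\<close>. Then

  \<open>\<langle>P\<^sub>n\<^sub>+\<^sub>1, z^j\<rangle> = (n - j) \<langle>P\<^sub>n, z^j\<rangle> + j \<langle>P\<^sub>n, z^(j - 1)\<rangle>\<close>,

  and for \<open>j \<le> n\<close> the right-hand side is zero as soon as \<open>P\<^sub>n\<close> is orthogonal to \<open>1, \<dots>, z^(n - 1)\<close>: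
  where orthogonality gives nothing, the factor \<open>n - j\<close> or \<open>j\<close> vanishes. So \<open>P\<^sub>n\<close> is, up to
  normalisation, the orthogonal polynomial of degree \<open>n\<close> (the weight being positive, there is only
  one). The two coefficients that matter can be read off from the recursion: the leading one is
  the Pochhammer symbol
  \<open>(b + 1)\<^sub>n\<close> and the constant one is \<open>(cnj b)\<^sub>n\<close>. Hence \<open>\<alpha>\<^sub>n\<^sub>-\<^sub>1 = - (b)\<^sub>n / (cnj b + 1)\<^sub>n\<close>
  (lemma \<open>verblunsky_weight\<close>).

  Consecutive coefficients thus satisfy \<open>\<alpha>\<^sub>n (cnj d + 1) = \<alpha>\<^sub>n\<^sub>-\<^sub>1 d\<close> with \<open>d = b + n\<close>, and both sides of
  the difference equation are equal to \<open>|\<alpha>\<^sub>n|^2 (d + cnj d + 1) / d\<close>.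
\<close>

section \<open>Integrability of the weight and boundary values\<close>

text \<open>
  Boundary terms of this form occur in both applications of the fundamental theorem of calculus
  below.
\<close>

lemma tendsto_sin_half_powr:
  fixes H :: "real \<Rightarrow> 'a::real_normed_vector"
  assumes H: "continuous_on UNIV H" and e: "e > 0"
  shows "((\<lambda>\<theta>. sin (\<theta> / 2) powr e *\<^sub>R H \<theta>) \<longlongrightarrow> 0) (at_right 0)"
    and "((\<lambda>\<theta>. sin (\<theta> / 2) powr e *\<^sub>R H \<theta>) \<longlongrightarrow> 0) (at_left (2 * pi))"
proof -
  have nonneg: "0 \<le> sin (\<theta> / 2)" if "\<theta> \<in> {0<..<2 * pi}" for \<theta> :: real
    using that by (intro sin_ge_zero) auto
  have lim: "((\<lambda>\<theta>. sin (\<theta> / 2) powr e *\<^sub>R H \<theta>) \<longlongrightarrow> sin (a / 2) powr e *\<^sub>R H a) F"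
    if "F \<le> at a" and ev: "eventually (\<lambda>\<theta>. \<theta> \<in> {0<..<2 * pi}) F" and a: "sin (a / 2) = 0" for a F
  proof -
    have id: "((\<lambda>\<theta>. \<theta>) \<longlongrightarrow> a) F"
      using that(1) by (rule tendsto_mono) simp
    have "isCont H a"
      using H by (simp add: continuous_on_eq_continuous_at)
    then have Ha: "(H \<longlongrightarrow> H a) F"
      using that(1) unfolding isCont_def by (rule tendsto_mono[rotated])
    have "((\<lambda>\<theta>. sin (\<theta> / 2) powr e) \<longlongrightarrow> sin (a / 2) powr e) F"
    proof (rule tendsto_powr2)
      show "((\<lambda>\<theta>. sin (\<theta> / 2)) \<longlongrightarrow> sin (a / 2)) F"
        by (intro tendsto_intros id) simp
      show "\<forall>\<^sub>F \<theta> in F. 0 \<le> sin (\<theta> / 2)"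
        using ev nonneg by (rule eventually_mono)
    qed (use e in auto)
    then show ?thesis
      by (rule tendsto_scaleR) (rule Ha)
  qed
  show "((\<lambda>\<theta>. sin (\<theta> / 2) powr e *\<^sub>R H \<theta>) \<longlongrightarrow> 0) (at_right 0)"
    using lim[of "at_right 0" 0] eventually_at_right_real[of 0 "2 * pi"]
    by (simp add: at_le)
  show "((\<lambda>\<theta>. sin (\<theta> / 2) powr e *\<^sub>R H \<theta>) \<longlongrightarrow> 0) (at_left (2 * pi))"
    using lim[of "at_left (2 * pi)" "2 * pi"] eventually_at_left_real[of 0 "2 * pi"]
    by (simp add: at_le)
qed

lemma sin_half_pos: "0 < \<theta> \<Longrightarrow> \<theta> < 2 * pi \<Longrightarrow> 0 < sin (\<theta> / 2)"
  by (intro sin_gt_zero) auto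

text \<open>
  The singularities at the two endpoints are treated together. The derivative of
  \<open>sin (\<theta> / 2) powr (a + 1) * cos (\<theta> / 2)\<close> is a positive multiple of \<open>sin (\<theta> / 2) powr a\<close> minus a
  multiple of the bounded function \<open>sin (\<theta> / 2) powr (a + 2)\<close>. Adding the linear term
  \<open>(a + 2) / 2 * \<theta>\<close> makes the derivative \<open>f\<close> nonnegative, hence integrable by the fundamental
  theorem of calculus, and \<open>f\<close> dominates \<open>(a + 1) / 2 * sin (\<theta> / 2) powr a\<close>.
\<close>
lemma sin_half_powr_integrable:
  assumes a: "a > -1"
  shows "set_integrable lborel {0<..<2 * pi} (\<lambda>\<theta>. sin (\<theta> / 2) powr a)"
proof -
  define F where "F = (\<lambda>\<theta>. sin (\<theta> / 2) powr (a + 1) *\<^sub>R cos (\<theta> / 2) + (a + 2) / 2 * \<theta>)"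
  define f where "f = (\<lambda>\<theta>. (a + 1) / 2 * sin (\<theta> / 2) powr a
                        - (a + 2) / 2 * sin (\<theta> / 2) powr (a + 2) + (a + 2) / 2)"
  have le1: "sin (\<theta> / 2) powr (a + 2) \<le> 1" if "0 < \<theta>" "\<theta> < 2 * pi" for \<theta>
    using a sin_half_pos[OF that] powr_mono2[of "a + 2" "sin (\<theta> / 2)" 1] by simp
  have "set_integrable lborel (einterval 0 (2 * pi)) f"
  proof (rule interval_integral_FTC_nonneg(1))
    show "(0::ereal) < ereal (2 * pi)" by simp
    fix \<theta> assume t: "0 < ereal \<theta>" "ereal \<theta> < ereal (2 * pi)"
    then have s: "0 < sin (\<theta> / 2)" by (intro sin_half_pos) auto
    show "isCont f \<theta>"
      unfolding f_def using s by (auto intro!: continuous_intros)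
    have p: "sin (\<theta> / 2) powr (a + 1) = sin (\<theta> / 2) * sin (\<theta> / 2) powr a"
            "sin (\<theta> / 2) powr (a + 2) = (sin (\<theta> / 2))\<^sup>2 * sin (\<theta> / 2) powr a"
      using s by (simp_all add: powr_add powr_numeral)
    have "(F has_real_derivative
            (a + 1) * sin (\<theta> / 2) powr a * (cos (\<theta> / 2) / 2) * cos (\<theta> / 2)
              + sin (\<theta> / 2) powr (a + 1) * (- sin (\<theta> / 2) / 2) + (a + 2) / 2) (at \<theta>)"
      unfolding F_def real_scaleR_def using s
      by (auto intro!: derivative_eq_intros has_real_derivative_powr' simp: powr_diff field_simps)
    also have "(a + 1) * sin (\<theta> / 2) powr a * (cos (\<theta> / 2) / 2) * cos (\<theta> / 2)
              + sin (\<theta> / 2) powr (a + 1) * (- sin (\<theta> / 2) / 2) + (a + 2) / 2 = f \<theta>"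
    proof -
      have c: "(cos (\<theta> / 2))\<^sup>2 = 1 - (sin (\<theta> / 2))\<^sup>2" by (rule cos_squared_eq)
      have "(a + 1) * sin (\<theta> / 2) powr a * (cos (\<theta> / 2) / 2) * cos (\<theta> / 2)
         = (a + 1) / 2 * sin (\<theta> / 2) powr a * (cos (\<theta> / 2))\<^sup>2"
        by (simp add: power2_eq_square)
      then show ?thesis
        unfolding f_def p c by (simp add: algebra_simps power2_eq_square divide_simps)
    qed
    finally show "(F has_real_derivative f \<theta>) (at \<theta>)" .
  next
    have "0 \<le> f \<theta>" if "0 < \<theta>" "\<theta> < 2 * pi" for \<theta>
    proof -
      have "(a + 2) / 2 * sin (\<theta> / 2) powr (a + 2) \<le> (a + 2) / 2 * 1"
        using a le1[OF that] by (intro mult_left_mono) auto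
      moreover have "0 \<le> (a + 1) / 2 * sin (\<theta> / 2) powr a"
        using a by simp
      ultimately show ?thesis unfolding f_def by linarith
    qed
    then show "AE \<theta> in lborel. 0 < ereal \<theta> \<longrightarrow> ereal \<theta> < ereal (2 * pi) \<longrightarrow> 0 \<le> f \<theta>"
      by simp
  next
    have L: "(F \<longlongrightarrow> 0 + (a + 2) / 2 * 0) (at_right 0)"
      unfolding F_def using a
      by (intro tendsto_add tendsto_mult tendsto_sin_half_powr(1) continuous_intros tendsto_const)
         (auto intro: tendsto_ident_at)
    have R: "(F \<longlongrightarrow> 0 + (a + 2) / 2 * (2 * pi)) (at_left (2 * pi))"
      unfolding F_def using a
      by (intro tendsto_add tendsto_mult tendsto_sin_half_powr(2) continuous_intros tendsto_const)
         (auto intro: tendsto_ident_at)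
    show "((F \<circ> real_of_ereal) \<longlongrightarrow> 0 + (a + 2) / 2 * 0) (at_right 0)"
      using L by (simp add: ereal_tendsto_simps zero_ereal_def)
    show "((F \<circ> real_of_ereal) \<longlongrightarrow> 0 + (a + 2) / 2 * (2 * pi)) (at_left (ereal (2 * pi)))"
      using R by (simp add: ereal_tendsto_simps)
  qed
  then have int: "set_integrable lborel {0<..<2 * pi} (\<lambda>\<theta>. 2 / (a + 1) * f \<theta>)"
    by (intro set_integrable_mult_right) (simp add: zero_ereal_def)
  show ?thesis
  proof (rule set_integrable_bound[OF int])
    show "set_borel_measurable lborel {0<..<2 * pi} (\<lambda>\<theta>. sin (\<theta> / 2) powr a)"
      unfolding set_borel_measurable_def by measurable
    have "norm (sin (\<theta> / 2) powr a) \<le> norm (2 / (a + 1) * f \<theta>)" if "0 < \<theta>" "\<theta> < 2 * pi" for \<theta>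
    proof -
      have "(a + 2) / 2 * sin (\<theta> / 2) powr (a + 2) \<le> (a + 2) / 2 * 1"
        using a le1[OF that] by (intro mult_left_mono) auto
      then have "(a + 1) / 2 * sin (\<theta> / 2) powr a \<le> f \<theta>" unfolding f_def by linarith
      then have "2 / (a + 1) * ((a + 1) / 2 * sin (\<theta> / 2) powr a) \<le> 2 / (a + 1) * f \<theta>"
        using a by (intro mult_left_mono) auto
      then have "sin (\<theta> / 2) powr a \<le> 2 / (a + 1) * f \<theta>" using a by simp
      moreover have "0 \<le> sin (\<theta> / 2) powr a" by simp
      ultimately show ?thesis by (metis abs_of_nonneg order_trans real_norm_def)
    qed
    then show "AE \<theta> in lborel. \<theta> \<in> {0<..<2 * pi} \<longrightarrow>
        norm (sin (\<theta> / 2) powr a) \<le> norm (2 / (a + 1) * f \<theta>)"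
      by simp
  qed
qed

text \<open>
  On this interval \<open>sin (\<theta> / 2)\<close> is nonnegative, so the square and the real power can be merged; at
  the endpoints both sides are zero by the convention for \<open>0 powr x\<close>.
\<close>
lemma weight_eq:
  assumes "\<theta> \<in> {0..2 * pi}"
  shows "weight \<eta> lam \<theta> = tau (Complex lam \<eta>) * exp (- \<eta> * \<theta>) * sin (\<theta> / 2) powr (2 * lam)"
proof -
  have "0 \<le> sin (\<theta> / 2)"
    using assms by (intro sin_ge_zero) auto
  then have "(sin (\<theta> / 2))\<^sup>2 = sin (\<theta> / 2) powr 2"
    by (cases "sin (\<theta> / 2) = 0") (simp_all add: powr_numeral)
  then show ?thesis unfolding weight_def by (simp add: powr_powr)
qed

lemma set_integrable_continuous_times:
  fixes g :: "real \<Rightarrow> 'a::{real_normed_field, banach, second_countable_topology}" and w :: "real \<Rightarrow> real"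
  assumes w: "set_integrable lborel {x..y} w" and g: "continuous_on UNIV g"
  shows "set_integrable lborel {x..y} (\<lambda>\<theta>. g \<theta> * of_real (w \<theta>))"
proof -
  have "compact (g ` {x..y})"
    using g by (intro compact_continuous_image) (auto intro: continuous_on_subset)
  then obtain B where B: "\<And>\<theta>. \<theta> \<in> {x..y} \<Longrightarrow> norm (g \<theta>) \<le> B"
    by (meson bounded_iff compact_imp_bounded imageI)
  have gm: "g \<in> borel_measurable borel"
    using g by (rule borel_measurable_continuous_onI)
  have wm: "(\<lambda>\<theta>. indicator {x..y} \<theta> *\<^sub>R w \<theta>) \<in> borel_measurable lborel"
    using w unfolding set_integrable_def by (rule borel_measurable_integrable)
  show ?thesis
  proof (rule set_integrable_bound)
    show "set_integrable lborel {x..y} (\<lambda>\<theta>. B * w \<theta>)"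
      using w by simp
    have "(\<lambda>\<theta>. g \<theta> * of_real (indicator {x..y} \<theta> *\<^sub>R w \<theta>)) \<in> borel_measurable lborel"
      using gm wm by measurable
    then show "set_borel_measurable lborel {x..y} (\<lambda>\<theta>. g \<theta> * of_real (w \<theta>))"
      unfolding set_borel_measurable_def
      by (rule back_subst[of "\<lambda>f. f \<in> borel_measurable lborel"]) (auto simp: fun_eq_iff indicator_def)
    show "AE \<theta> in lborel. \<theta> \<in> {x..y} \<longrightarrow> norm (g \<theta> * of_real (w \<theta>)) \<le> norm (B * w \<theta>)"
    proof (intro AE_I2 impI)
      fix \<theta> assume "\<theta> \<in> {x..y}"
      from B[OF this] have "norm (g \<theta>) \<le> \<bar>B\<bar>" by linarith
      then show "norm (g \<theta> * of_real (w \<theta>)) \<le> norm (B * w \<theta>)"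
        by (simp add: norm_mult abs_mult mult_right_mono)
    qed
  qed
qed

lemma tau_pos:
  assumes "Re b > - 1 / 2"
  shows "tau b > 0"
proof -
  have "Gamma (b + 1) \<noteq> 0"
  proof
    assume "Gamma (b + 1) = 0"
    then have "b + 1 \<in> \<int>\<^sub>\<le>\<^sub>0" by (simp add: Gamma_eq_zero_iff)
    then obtain n where "b + 1 = - of_nat n" by (auto elim: nonpos_Ints_cases')
    then have "Re (b + 1) = - real n" by simp
    with assms show False by simp
  qed
  then show ?thesis
    unfolding tau_def using assms by (auto intro!: divide_pos_pos mult_pos_pos Gamma_real_pos)
qed

lemma weight_pos:
  assumes "lam > - 1 / 2" "0 < \<theta>" "\<theta> < 2 * pi"
  shows "weight \<eta> lam \<theta> > 0"
  using assms sin_half_pos[of \<theta>] tau_pos[of "Complex lam \<eta>"] by (simp add: weight_eq)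

lemma weight_integrable:
  assumes lam: "lam > - 1 / 2"
  shows "set_integrable lborel {0..2 * pi} (weight \<eta> lam)"
proof -
  define h where "h = (\<lambda>\<theta>. sin (\<theta> / 2) powr (2 * lam))"
  have "set_integrable lborel {0<..<2 * pi} h"
    using lam unfolding h_def by (intro sin_half_powr_integrable) auto
  then have h: "set_integrable lborel {0..2 * pi} h"
    unfolding set_integrable_def
  proof (rule back_subst[of "integrable lborel"], intro ext)
    fix \<theta>
    show "indicator {0<..<2 * pi} \<theta> *\<^sub>R h \<theta> = indicator {0..2 * pi} \<theta> *\<^sub>R h \<theta>"
      by (cases "\<theta> = 0 \<or> \<theta> = 2 * pi") (auto simp: indicator_def h_def)
  qed
  have "set_integrable lborel {0..2 * pi}
      (\<lambda>\<theta>. tau (Complex lam \<eta>) * exp (- \<eta> * \<theta>) * of_real (h \<theta>))"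
    by (rule set_integrable_continuous_times[OF h]) (intro continuous_intros)
  then show ?thesis
    unfolding set_integrable_def
    by (rule back_subst[of "integrable lborel"])
       (auto simp: fun_eq_iff indicator_def h_def weight_eq)
qed


section \<open>Uniqueness of the monic orthogonal polynomials\<close>

locale circle_weight =
  fixes w :: "real \<Rightarrow> real"
  assumes integrable: "set_integrable lborel {0..2 * pi} w"
    and pos: "0 < \<theta> \<Longrightarrow> \<theta> < 2 * pi \<Longrightarrow> w \<theta> > 0"
begin

lemma integrand_integrable:
  assumes "continuous_on UNIV f" "continuous_on UNIV g"
  shows "set_integrable lborel {0..2 * pi} (\<lambda>\<theta>. f (cis \<theta>) * cnj (g (cis \<theta>)) * of_real (w \<theta>))"
proof (rule set_integrable_continuous_times[OF integrable])
  have "continuous_on UNIV (\<lambda>\<theta>. h (cis \<theta>))" if "continuous_on UNIV h" for h :: "complex \<Rightarrow> complex"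
    using that by (rule continuous_on_compose2) (auto intro: continuous_intros)
  note this[OF assms(1)] this[OF assms(2)]
  then show "continuous_on UNIV (\<lambda>\<theta>. f (cis \<theta>) * cnj (g (cis \<theta>)))"
    by (intro continuous_intros)
qed

lemma inner_diff_left:
  assumes "continuous_on UNIV g"
  shows "circle_inner w (poly (p - q)) g = circle_inner w (poly p) g - circle_inner w (poly q) g"
  unfolding circle_inner_def poly_diff left_diff_distrib
  by (intro set_integral_diff integrand_integrable assms continuous_intros)

lemma inner_smult_left:
  "circle_inner w (poly (smult c p)) g = c * circle_inner w (poly p) g"
  unfolding circle_inner_def poly_smult mult.assoc by (rule set_integral_mult_right)

text \<open>Multiplication by \<open>z\<close> is an isometry, since \<open>z * cnj z = 1\<close> on the circle.\<close>
lemma inner_shift: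
  "circle_inner w (poly (pCons 0 p)) (\<lambda>z. z ^ Suc j) = circle_inner w (poly p) (\<lambda>z. z ^ j)"
  unfolding circle_inner_def
proof (intro set_lebesgue_integral_cong ballI allI impI)
  fix \<theta> :: real
  have "cis \<theta> * cnj (cis \<theta>) = 1" by (simp add: cis_cnj cis_mult)
  then show "poly (pCons 0 p) (cis \<theta>) * cnj (cis \<theta> ^ Suc j) * of_real (w \<theta>) =
      poly p (cis \<theta>) * cnj (cis \<theta> ^ j) * of_real (w \<theta>)"
    by (simp add: mult_ac)
qed simp

lemma inner_poly_right:
  "circle_inner w (poly p) (poly q) = (\<Sum>k\<le>degree q. cnj (coeff q k) * circle_inner w (poly p) (\<lambda>z. z ^ k))"
proof -
  have int: "set_integrable lborel {0..2 * pi}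
      (\<lambda>\<theta>. cnj (coeff q k) * (poly p (cis \<theta>) * cnj (cis \<theta> ^ k) * of_real (w \<theta>)))" for k
    by (intro set_integrable_mult_right integrand_integrable continuous_intros)
  have "circle_inner w (poly p) (poly q)
     = (LBINT \<theta>:{0..2*pi}. (\<Sum>k\<le>degree q. cnj (coeff q k) *
          (poly p (cis \<theta>) * cnj (cis \<theta> ^ k) * of_real (w \<theta>))))"
    unfolding circle_inner_def poly_altdef[of q]
    by (simp add: sum_distrib_left sum_distrib_right mult_ac)
  also have "\<dots> = (\<Sum>k\<le>degree q. LBINT \<theta>:{0..2*pi}. cnj (coeff q k) *
          (poly p (cis \<theta>) * cnj (cis \<theta> ^ k) * of_real (w \<theta>)))"
    using int unfolding set_lebesgue_integral_def set_integrable_def scaleR_sum_right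
    by (intro Bochner_Integration.integral_sum)
  finally show ?thesis unfolding circle_inner_def by simp
qed

text \<open>
  If the integral of \<open>|p|^2 * w\<close> vanishes, then \<open>p\<close> is zero at almost every point of the circle. A
  nonzero polynomial has finitely many roots, and finitely many points cannot fill an arc.
\<close>
lemma inner_self_eq_0:
  assumes "circle_inner w (poly p) (poly p) = 0"
  shows "p = 0"
proof (rule ccontr)
  assume "p \<noteq> 0"
  define g where "g = (\<lambda>\<theta>. (norm (poly p (cis \<theta>)))\<^sup>2 * w \<theta>)"
  have eq: "poly p (cis \<theta>) * cnj (poly p (cis \<theta>)) * of_real (w \<theta>) = complex_of_real (g \<theta>)" for \<theta>
    unfolding g_def of_real_mult complex_norm_square ..
  have int: "set_integrable lborel {0..2 * pi} g"
    using integrand_integrable[of "poly p" "poly p"] unfolding eq set_integrable_def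
    by (simp add: scaleR_conv_of_real continuous_intros complex_of_real_integrable_eq flip: of_real_mult)
  have "(LBINT \<theta>:{0..2*pi}. g \<theta>) = 0"
    using assms unfolding circle_inner_def eq set_lebesgue_integral_def
    by (simp add: scaleR_conv_of_real flip: of_real_mult)
  then have zero: "(LBINT \<theta>:{0<..<2*pi}. g \<theta>) = 0"
    using interval_integral_Icc[of 0 "2 * pi" g] interval_integral_Ioo[of 0 "2 * pi" g]
    by (simp add: zero_ereal_def)
  have int': "set_integrable lborel {0<..<2 * pi} g"
    by (rule set_integrable_subset[OF int]) auto
  have "AE \<theta> in lborel. indicator {0<..<2 * pi} \<theta> *\<^sub>R g \<theta> = 0"
    using zero int' pos unfolding set_lebesgue_integral_def set_integrable_def
    by (subst integral_nonneg_eq_0_iff_AE[symmetric]) (auto simp: indicator_def g_def less_imp_le)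
  then have AE: "AE \<theta> in lborel. \<theta> \<in> {0<..<2 * pi} \<longrightarrow> poly p (cis \<theta>) = 0"
    by (rule AE_mp) (auto intro!: AE_I2 simp: g_def dest: pos)
  have inj: "inj_on cis {0<..<2 * pi}"
  proof (rule inj_onI)
    fix x y assume "x \<in> {0<..<2 * pi}" "y \<in> {0<..<2 * pi}" "cis x = cis y"
    then show "x = y"
      by (metis Arg2pi_unique cis_conv_exp greaterThanLessThan_iff less_imp_le mult_1 of_real_1 zero_less_one)
  qed
  define Z where "Z = {\<theta> \<in> {0<..<2 * pi}. poly p (cis \<theta>) = 0}"
  have "cis ` Z \<subseteq> {z. poly p z = 0}" unfolding Z_def by auto
  then have "finite (cis ` Z)"
    using poly_roots_finite[OF \<open>p \<noteq> 0\<close>] finite_subset by blast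
  moreover have "inj_on cis Z" using inj by (rule inj_on_subset) (auto simp: Z_def)
  ultimately have "finite Z" by (simp add: finite_image_iff)
  then have "AE \<theta> in lborel. \<theta> \<notin> Z"
    by (intro AE_not_in) (simp add: finite_imp_null_set_lborel)
  with AE have "AE \<theta> in lborel. \<theta> \<notin> {0<..<2 * pi}"
    by (auto simp: Z_def)
  then have "emeasure lborel {0<..<2 * pi} = 0"
    by (subst (asm) AE_iff_measurable[of "{0<..<2 * pi}"]) auto
  then show False by simp
qed

text \<open>
  The difference of two monic orthogonal polynomials has degree below \<open>n\<close>, so it is orthogonal to
  itself.
\<close>
lemma is_monic_opuc_unique:
  assumes p: "is_monic_opuc w n p" and q: "is_monic_opuc w n q"
  shows "p = q"
proof (cases "n = 0")
  case True
  with p q show ?thesis by (simp add: is_monic_opuc_0_iff)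
next
  case False
  have co: "coeff (p - q) k = 0" if "k \<ge> n" for k
    using p q that by (cases "k = n") (auto simp: is_monic_opuc_def coeff_eq_0)
  then have deg: "degree (p - q) < n"
    using False degree_lessI[of "p - q" n] by blast
  have "circle_inner w (poly (p - q)) (\<lambda>z. z ^ k) = 0" if "k < n" for k
    using p q that by (subst inner_diff_left) (auto simp: is_monic_opuc_def intro!: continuous_intros)
  then have "circle_inner w (poly (p - q)) (poly (p - q)) = 0"
    unfolding inner_poly_right using deg by (intro sum.neutral) auto
  then show ?thesis using inner_self_eq_0 by force
qed

lemma monic_opuc_eqI: "is_monic_opuc w n p \<Longrightarrow> monic_opuc w n = p"
  unfolding monic_opuc_def by (rule the_equality) (auto intro: is_monic_opuc_unique)

end

section \<open>The Pearson equation of the weight\<close>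

lemma circle_weight_weight: "lam > - 1 / 2 \<Longrightarrow> circle_weight (weight \<eta> lam)"
  by unfold_locales (auto intro: weight_integrable weight_pos)

lemma half_angle:
  "cis (\<theta> / 2) * complex_of_real (sin (\<theta> / 2)) = \<i> * (1 - cis \<theta>) / 2"
  "cis (\<theta> / 2) * complex_of_real (cos (\<theta> / 2)) = (1 + cis \<theta>) / 2"
proof -
  have "cis \<theta> = Complex ((cos (\<theta> / 2))\<^sup>2 - (sin (\<theta> / 2))\<^sup>2) (2 * sin (\<theta> / 2) * cos (\<theta> / 2))"
    using cos_double[of "\<theta> / 2"] sin_double[of "\<theta> / 2"] by (simp add: complex_eq_iff)
  then show "cis (\<theta> / 2) * complex_of_real (sin (\<theta> / 2)) = \<i> * (1 - cis \<theta>) / 2"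
    "cis (\<theta> / 2) * complex_of_real (cos (\<theta> / 2)) = (1 + cis \<theta>) / 2"
    by (auto simp: complex_eq_iff cos_squared_eq power2_eq_square[symmetric] algebra_simps)
qed

text \<open>
  The function differentiated here is \<open>- \<i> * (1 - z) * p z * cnj z ^ j * w\<close>. It is written with
  \<open>1 - z = - 2 * \<i> * cis (\<theta> / 2) * sin (\<theta> / 2)\<close>, which absorbs the zero of \<open>1 - z\<close> into the power of
  the sine, so that its vanishing at the endpoints is visible. The derivative is again a polynomial
  in \<open>z\<close> times \<open>cnj z ^ j * w\<close>, because \<open>(1 - z) * cot (\<theta> / 2) = - \<i> * (1 + z)\<close>.
\<close>
lemma pearson_derivative:
  assumes t: "0 < \<theta>" "\<theta> < 2 * pi" and b: "b = Complex lam \<eta>"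
  shows "((\<lambda>\<theta>. cis (\<theta> / 2) * (poly p (cis \<theta>) * (cis (- (real j * \<theta>)) *
            of_real (- 2 * tau b * exp (- \<eta> * \<theta>) * sin (\<theta> / 2) powr (2 * lam + 1)))))
          has_vector_derivative
            poly ([:0, 1, -1:] * pderiv p - smult (cnj b) p - smult (b + 1) (pCons 0 p)
                  - smult (of_nat j) (p - pCons 0 p)) (cis \<theta>)
              * cnj (cis \<theta> ^ j) * of_real (weight \<eta> lam \<theta>)) (at \<theta>)"
proof -
  define z where "z = cis \<theta>"
  define u where "u = cis (\<theta> / 2)"
  define C where "C = cis (- (real j * \<theta>))"
  define s c where "s = sin (\<theta> / 2)" and "c = cos (\<theta> / 2)"
  define W where "W = weight \<eta> lam \<theta>"
  have s: "s > 0" unfolding s_def using t by (rule sin_half_pos)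
  have W: "W = tau b * exp (- \<eta> * \<theta>) * s powr (2 * lam)"
    unfolding W_def s_def b using t by (intro weight_eq) auto
  have us: "u * of_real s = \<i> * (1 - z) / 2" and uc: "u * of_real c = (1 + z) / 2"
    unfolding u_def s_def c_def z_def by (rule half_angle)+
  define g where "g = (\<lambda>\<theta>. - 2 * tau b * exp (- \<eta> * \<theta>) * sin (\<theta> / 2) powr (2 * lam + 1))"
  have pw: "s powr (2 * lam + 1) = s powr (2 * lam) * s"
    using s by (simp add: powr_add)
  have "(g has_real_derivative
      (- 2 * tau b * (- \<eta> * exp (- \<eta> * \<theta>))) * s powr (2 * lam + 1)
        + (- 2 * tau b * exp (- \<eta> * \<theta>)) * ((2 * lam + 1) * s powr (2 * lam) * (c / 2))) (at \<theta>)"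
    unfolding g_def using s unfolding s_def c_def
    by (auto intro!: derivative_eq_intros has_real_derivative_powr' simp: powr_diff field_simps)
  also have "(- 2 * tau b * (- \<eta> * exp (- \<eta> * \<theta>))) * s powr (2 * lam + 1)
        + (- 2 * tau b * exp (- \<eta> * \<theta>)) * ((2 * lam + 1) * s powr (2 * lam) * (c / 2))
     = W * (2 * \<eta> * s - (2 * lam + 1) * c)"
    unfolding W pw by (simp add: algebra_simps)
  finally have dg: "((\<lambda>\<theta>. complex_of_real (g \<theta>)) has_vector_derivative
      of_real (W * (2 * \<eta> * s - (2 * lam + 1) * c))) (at \<theta>)"
    by (intro has_vector_derivative_of_real) (simp add: has_real_derivative_iff_has_vector_derivative)
  have g: "g \<theta> = - 2 * W * s"
    unfolding g_def W s_def[symmetric] pw by simp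
  have du: "((\<lambda>\<theta>. cis (\<theta> / 2)) has_vector_derivative \<i> / 2 * u) (at \<theta>)"
    unfolding u_def has_vector_derivative_def
    by (auto intro!: derivative_eq_intros simp: scaleR_conv_of_real)
  have dC: "((\<lambda>\<theta>. cis (- (real j * \<theta>))) has_vector_derivative - (\<i> * of_nat j * C)) (at \<theta>)"
    unfolding C_def has_vector_derivative_def
    by (auto intro!: derivative_eq_intros simp: scaleR_conv_of_real)
  have "(cis has_vector_derivative \<i> * z) (at \<theta>)"
    unfolding z_def has_vector_derivative_def
    by (auto intro!: derivative_eq_intros simp: scaleR_conv_of_real)
  from field_vector_diff_chain_at[OF this poly_DERIV]
  have dp: "((\<lambda>\<theta>. poly p (cis \<theta>)) has_vector_derivative \<i> * z * poly (pderiv p) z) (at \<theta>)"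
    by (simp add: o_def z_def)
  have Cj: "cnj (cis \<theta> ^ j) = C"
    unfolding C_def by (simp add: cis_cnj Complex.DeMoivre)
  \<comment> \<open>Each term of the product rule contains \<open>u\<close> times the real factor \<open>g\<close> or its derivative; these
      products are \<open>W\<close> times polynomials in \<open>z\<close>, so the half angle disappears.\<close>
  have k1: "u * of_real (g \<theta>) = - \<i> * (1 - z) * of_real W"
  proof -
    have "u * of_real (g \<theta>) = -2 * of_real W * (u * of_real s)" unfolding g by simp
    then show ?thesis unfolding us by simp
  qed
  have k2: "u * of_real (W * (2 * \<eta> * s - (2 * lam + 1) * c))
      = of_real W * (\<i> * of_real \<eta> * (1 - z) - (of_real lam + 1 / 2) * (1 + z))"
  proof -
    have "u * of_real (W * (2 * \<eta> * s - (2 * lam + 1) * c))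
      = of_real W * (2 * of_real \<eta> * (u * of_real s) - (2 * of_real lam + 1) * (u * of_real c))"
      by (simp add: algebra_simps)
    also have "\<dots> = of_real W * (\<i> * of_real \<eta> * (1 - z) - (of_real lam + 1 / 2) * (1 + z))"
      unfolding us uc by (simp add: field_simps)
    finally show ?thesis .
  qed
  let ?P = "poly p z" and ?D = "poly (pderiv p) z"
  have bb: "b = of_real lam + \<i> * of_real \<eta>" "cnj b = of_real lam - \<i> * of_real \<eta>"
    unfolding b by (simp_all add: complex_eq_iff)
  let ?deriv = "u * (?P * (C * of_real (W * (2 * \<eta> * s - (2 * lam + 1) * c))
                          + - (\<i> * of_nat j * C) * of_real (g \<theta>))
                     + \<i> * z * ?D * (C * of_real (g \<theta>)))
                + \<i> / 2 * u * (?P * (C * of_real (g \<theta>)))"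
  have "?deriv
      = ?P * C * (u * of_real (W * (2 * \<eta> * s - (2 * lam + 1) * c)))
        + (\<i> * z * ?D * C - \<i> * of_nat j * C * ?P + \<i> / 2 * ?P * C) * (u * of_real (g \<theta>))"
    by (simp add: algebra_simps)
  also have "\<dots> = (z * (1 - z) * ?D - cnj b * ?P - (b + 1) * (z * ?P) - of_nat j * (?P - z * ?P)) * C * of_real W"
    unfolding k1 k2 bb by (simp add: field_simps)
  also have "\<dots> = poly ([:0, 1, -1:] * pderiv p - smult (cnj b) p - smult (b + 1) (pCons 0 p)
                  - smult (of_nat j) (p - pCons 0 p)) z * C * of_real W"
    by (simp add: algebra_simps)
  finally have eq: "?deriv
      = poly ([:0, 1, -1:] * pderiv p - smult (cnj b) p - smult (b + 1) (pCons 0 p)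
                  - smult (of_nat j) (p - pCons 0 p)) z * C * of_real W" .
  have "((\<lambda>\<theta>. cis (\<theta> / 2) * (poly p (cis \<theta>) * (cis (- (real j * \<theta>)) * complex_of_real (g \<theta>))))
      has_vector_derivative ?deriv) (at \<theta>)"
    unfolding u_def z_def C_def
    by (intro has_vector_derivative_mult du[unfolded u_def] dp[unfolded z_def] dC[unfolded C_def] dg)
  then show ?thesis
    unfolding eq unfolding Cj z_def W_def g_def .
qed

text \<open>
  The derivative just computed has integral zero, since \<open>2 * lam + 1 > 0\<close> makes both boundary terms
  vanish. The term with the factor \<open>j\<close> comes from differentiating \<open>cnj z ^ j\<close>.
\<close>
lemma inner_pearson:
  assumes lam: "lam > - 1 / 2" and b: "b = Complex lam \<eta>"
  defines "w \<equiv> weight \<eta> lam"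
  shows "circle_inner w (poly ([:0, 1, -1:] * pderiv p - smult (cnj b) p - smult (b + 1) (pCons 0 p))) (\<lambda>z. z ^ j)
       = of_nat j * circle_inner w (poly (p - pCons 0 p)) (\<lambda>z. z ^ j)"
proof -
  interpret circle_weight w
    unfolding w_def using lam by (rule circle_weight_weight)
  define Q where "Q = [:0, 1, -1:] * pderiv p - smult (cnj b) p - smult (b + 1) (pCons 0 p)"
  define f where "f = (\<lambda>\<theta>. poly (Q - smult (of_nat j) (p - pCons 0 p)) (cis \<theta>)
              * cnj (cis \<theta> ^ j) * complex_of_real (w \<theta>))"
  define H where "H = (\<lambda>\<theta>. - 2 * complex_of_real (tau b * exp (- \<eta> * \<theta>)) * cis (\<theta> / 2)
              * poly p (cis \<theta>) * cis (- (real j * \<theta>)))"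
  define F where "F = (\<lambda>\<theta>. sin (\<theta> / 2) powr (2 * lam + 1) *\<^sub>R H \<theta>)"
  have Feq: "F = (\<lambda>\<theta>. cis (\<theta> / 2) * (poly p (cis \<theta>) * (cis (- (real j * \<theta>)) *
            of_real (- 2 * tau b * exp (- \<eta> * \<theta>) * sin (\<theta> / 2) powr (2 * lam + 1)))))"
    unfolding F_def H_def by (simp add: fun_eq_iff scaleR_conv_of_real)
  have H: "continuous_on UNIV H"
    unfolding H_def by (intro continuous_intros) simp
  have int: "set_integrable lborel {0..2 * pi} f"
    unfolding f_def by (intro integrand_integrable continuous_intros)
  have "(LBINT \<theta>=0..2 * pi. f \<theta>) = 0 - 0"
  proof (rule interval_integral_FTC_integrable)
    show "(0::ereal) < ereal (2 * pi)" by simp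
    show "set_integrable lborel (einterval 0 (ereal (2 * pi))) f"
      unfolding zero_ereal_def einterval_eq by (rule set_integrable_subset[OF int]) auto
    show "((F \<circ> real_of_ereal) \<longlongrightarrow> 0) (at_right 0)"
      using tendsto_sin_half_powr(1)[OF H, of "2 * lam + 1"] lam
      unfolding F_def by (simp add: ereal_tendsto_simps zero_ereal_def)
    show "((F \<circ> real_of_ereal) \<longlongrightarrow> 0) (at_left (ereal (2 * pi)))"
      using tendsto_sin_half_powr(2)[OF H, of "2 * lam + 1"] lam
      unfolding F_def by (simp add: ereal_tendsto_simps)
    fix \<theta> assume "0 < ereal \<theta>" "ereal \<theta> < ereal (2 * pi)"
    then have t: "0 < \<theta>" "\<theta> < 2 * pi" by auto
    show "(F has_vector_derivative f \<theta>) (at \<theta>)"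
      unfolding Feq f_def Q_def w_def using t b by (rule pearson_derivative)
    have "isCont w \<theta>"
      unfolding w_def weight_def using sin_half_pos[OF t] by (auto intro!: continuous_intros)
    moreover have "continuous_on UNIV cis" by (intro continuous_intros)
    then have "isCont cis \<theta>" by (simp add: continuous_on_eq_continuous_at)
    ultimately show "isCont f \<theta>"
      unfolding f_def by (intro continuous_intros)
  qed
  then have "(LBINT \<theta>:{0..2 * pi}. f \<theta>) = 0"
    using interval_integral_Icc[of 0 "2 * pi" f] by (simp add: zero_ereal_def)
  then have "circle_inner w (poly (Q - smult (of_nat j) (p - pCons 0 p))) (\<lambda>z. z ^ j) = 0"
    unfolding f_def circle_inner_def .
  moreover have "continuous_on UNIV (\<lambda>z::complex. z ^ j)" by (intro continuous_intros)
  ultimately show ?thesis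
    unfolding Q_def by (simp only: inner_diff_left inner_smult_left) simp
qed

section \<open>The orthogonal polynomials of the weight\<close>

text \<open>
  These are the polynomials with coefficients \<open>(n choose k) * (b + 1)\<^sub>k * (cnj b)\<^sub>n\<^sub>-\<^sub>k\<close> in terms of
  Pochhammer symbols, that is, multiples of the hypergeometric polynomials
  \<open>F(-n, b + 1; b + cnj b + 1; 1 - z)\<close>. The definition by a raising operator is the form in which the
  Pearson equation applies.
\<close>
primrec circular_jacobi :: "complex \<Rightarrow> nat \<Rightarrow> complex poly" where
  "circular_jacobi b 0 = 1"
| "circular_jacobi b (Suc n) =
     (let p = circular_jacobi b n
      in smult (of_nat n) p - ([:0, 1, -1:] * pderiv p - smult (cnj b) p - smult (b + 1) (pCons 0 p)))"

text \<open>
  By the Pearson equation the moments of the next polynomial are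
  \<open>(n - j) \<langle>p, z^j\<rangle> + j \<langle>p, z^(j - 1)\<rangle>\<close>. The induction hypothesis covers the first term unless
  \<open>j = n\<close> and the second unless \<open>j = 0\<close>, and in these cases the coefficient is zero.
\<close>
lemma circular_jacobi_orthogonal:
  assumes lam: "lam > - 1 / 2" and b: "b = Complex lam \<eta>" and j: "j < n"
  shows "circle_inner (weight \<eta> lam) (poly (circular_jacobi b n)) (\<lambda>z. z ^ j) = 0"
  using j
proof (induction n arbitrary: j)
  case (Suc n)
  interpret circle_weight "weight \<eta> lam"
    using lam by (rule circle_weight_weight)
  let ?I = "\<lambda>p. circle_inner (weight \<eta> lam) (poly p) (\<lambda>z. z ^ j)"
  let ?p = "circular_jacobi b n"
  have cont: "continuous_on UNIV (\<lambda>z::complex. z ^ j)" by (intro continuous_intros)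
  have "?I (circular_jacobi b (Suc n)) = of_nat n * ?I ?p - of_nat j * ?I (?p - pCons 0 ?p)"
    unfolding circular_jacobi.simps Let_def inner_diff_left[OF cont, of "smult (of_nat n) _"]
      inner_smult_left inner_pearson[OF lam b] ..
  also have "\<dots> = (of_nat n - of_nat j) * ?I ?p + of_nat j * ?I (pCons 0 ?p)"
    unfolding inner_diff_left[OF cont] by (simp add: algebra_simps)
  also have "(of_nat n - of_nat j) * ?I ?p = 0"
    using Suc by (cases "j = n") auto
  also have "of_nat j * ?I (pCons 0 ?p) = 0"
  proof (cases j)
    case (Suc i)
    then show ?thesis
      using Suc.IH[of i] Suc.prems inner_shift[of ?p i] by simp
  qed simp
  finally show ?case by simp
qed simp

lemma coeff_circular_jacobi_Suc:
  "coeff (circular_jacobi b (Suc n)) k =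
     (of_nat n + cnj b - of_nat k) * coeff (circular_jacobi b n) k
     + (if k = 0 then 0 else (b + of_nat k) * coeff (circular_jacobi b n) (k - 1))"
  by (cases k; cases "k - 1") (simp_all add: Let_def coeff_pderiv algebra_simps)

lemma degree_circular_jacobi: "degree (circular_jacobi b n) \<le> n"
proof (induction n)
  case (Suc n)
  show ?case
    by (rule degree_le) (use Suc in \<open>auto simp: coeff_circular_jacobi_Suc coeff_eq_0 simp del: circular_jacobi.simps\<close>)
qed simp

lemma coeff_circular_jacobi_top: "coeff (circular_jacobi b n) n = pochhammer (b + 1) n"
proof (induction n)
  case (Suc n)
  then show ?case
    using degree_circular_jacobi[of b n]
    by (simp add: coeff_circular_jacobi_Suc coeff_eq_0 pochhammer_Suc algebra_simps del: circular_jacobi.simps)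
qed simp

lemma coeff_circular_jacobi_0: "coeff (circular_jacobi b n) 0 = pochhammer (cnj b) n"
  by (induction n)
     (simp_all add: coeff_circular_jacobi_Suc pochhammer_Suc algebra_simps del: circular_jacobi.simps(2))

text \<open>
  Since \<open>Re (b + 1) > 0\<close>, the leading coefficient is nonzero; the degree is therefore exactly \<open>n\<close> and
  the polynomial can be made monic.
\<close>
lemma monic_opuc_weight:
  assumes lam: "lam > - 1 / 2" and b: "b = Complex lam \<eta>"
  shows "monic_opuc (weight \<eta> lam) n = smult (1 / pochhammer (b + 1) n) (circular_jacobi b n)"
proof -
  interpret circle_weight "weight \<eta> lam"
    using lam by (rule circle_weight_weight)
  have nz: "pochhammer (b + 1) n \<noteq> 0"
  proof
    assume "pochhammer (b + 1) n = 0"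
    then obtain k where "b + 1 = - of_nat k" by (auto simp: pochhammer_eq_0_iff)
    then have "lam + 1 = - real k" unfolding b by (simp add: complex_eq_iff)
    with lam show False by linarith
  qed
  then have deg: "degree (circular_jacobi b n) = n"
    using degree_circular_jacobi[of b n] le_degree[of "circular_jacobi b n" n]
    by (simp add: coeff_circular_jacobi_top)
  show ?thesis
    using nz deg circular_jacobi_orthogonal[OF lam b]
    by (intro monic_opuc_eqI) (auto simp: is_monic_opuc_def inner_smult_left coeff_circular_jacobi_top)
qed

lemma complex_cnj_pochhammer: "cnj (pochhammer z n) = pochhammer (cnj z) n"
  by (simp add: pochhammer_prod)

section \<open>The difference equation\<close>

lemma verblunsky_weight:
  assumes "lam > - 1 / 2" and "b = Complex lam \<eta>"
  shows "verblunsky (weight \<eta> lam) (int n - 1) = - pochhammer b n / pochhammer (cnj b + 1) n"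
  using monic_opuc_weight[OF assms, of n]
  by (simp add: verblunsky_def poly_0_coeff_0 coeff_circular_jacobi_0 complex_cnj_pochhammer)

theorem theorem4p5:
  fixes \<eta> lam :: real and b :: complex and \<alpha> :: "int \<Rightarrow> complex" and n :: int
  assumes lam: "lam > - 1 / 2"
    and b: "b = complex_of_real lam + \<i> * complex_of_real \<eta>"
    and \<alpha>: "\<alpha> = verblunsky (weight \<eta> lam)"
    and n: "n \<ge> 1"
  shows "cnj (\<alpha> n) * (\<alpha> (n - 1) + \<alpha> n) =
           (cnj b + of_int n) * complex_of_real ((cmod (\<alpha> (n - 1)))\<^sup>2 - (cmod (\<alpha> n))\<^sup>2)"
proof -
  define m where "m = nat n"
  define x y d where "x = \<alpha> n" and "y = \<alpha> (n - 1)" and "d = b + of_int n"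
  have nm: "n = int m" using n unfolding m_def by simp
  have b': "b = Complex lam \<eta>" unfolding b by (simp add: complex_eq_iff)
  have "Re d > 0" "Re (cnj d + 1) > 0"
    using n lam unfolding d_def b by simp_all
  then have nz: "d \<noteq> 0" "cnj d + 1 \<noteq> 0" by (metis less_irrefl zero_complex.sel(1))+
  have y: "y = - pochhammer b m / pochhammer (cnj b + 1) m"
    unfolding y_def \<alpha> nm using lam b' by (rule verblunsky_weight)
  have "x = - pochhammer b (Suc m) / pochhammer (cnj b + 1) (Suc m)"
    using verblunsky_weight[OF lam b', of "Suc m"] unfolding x_def \<alpha> nm by simp
  then have "x = y * d / (cnj d + 1)"
    unfolding y d_def nm by (simp add: pochhammer_Suc add_ac)
  then have yx: "y = x * (cnj d + 1) / d"
    using nz by simp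
  have "cnj x * (y + x) = x * cnj x * (d + cnj d + 1) / d"
    unfolding yx using nz by (simp add: field_simps)
  also have "\<dots> = cnj d * (y * cnj y - x * cnj x)"
    unfolding yx using nz by (simp add: field_simps)
  also have "\<dots> = cnj d * complex_of_real ((cmod y)\<^sup>2 - (cmod x)\<^sup>2)"
    by (simp only: of_real_diff complex_norm_square)
  finally show ?thesis
    unfolding x_def y_def d_def by simp
qed

end
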